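(* The dihedral group $\mathbb{D}_n$ has a Lee metric for every $n\ge 1$.
   Context: $\mathbb{D}_n=\langle\rho,\tau:\rho^n=\tau^2=(\tau\rho)^2=e\rangle$ is the dihedral group of order $2n$ (so $\mathbb{D}_1\cong\mathbb{Z}_2$ and $\mathbb{D}_2\cong\mathbb{Z}_2^2$). All metrics on groups are integral (integer valued) and right translation invariant: $d(gh,g'h)=d(g,g')$ for all $g,g',h\in G$. The weight of $d$ is $w(x)=d(x,e)$, $e$ the identity of $G$. The partition induced by $d$, denoted $P(G,d)$, is the set of classes of the equivalence relation $g\sim h\Leftrightarrow w(g)=w(h)$. An interval metric is such a metric $d$ with finitely many weights and without gaps: if $P(G,d)$ has $m$ parts different from $\{e\}$, then the set of values of $w$ is exactly $\{0,1,\ldots,m\}$. The Lee partition of $G$ is $\mathcal{P}_{Lee}(G)=\{\{a,a^{-1}\}:a\in G\}$. A Lee metric on $G$ is an interval metric $d$ on $G$ with $P(G,d)=\mathcal{P}_{Lee}(G)$. *)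

theory Defs
  imports "HOL-Analysis.Abstract_Metric_Spaces" "HOL-Algebra.Group"
begin

section \<open>Groups given by generators and relators\<close>

text \<open>The letter \<open>(x, True)\<close> stands for the generator \<open>x\<close>, and \<open>(x, False)\<close> for its formal inverse.\<close>

type_synonym 'g gword = "('g \<times> bool) list"

inductive word_eq :: "'g gword set \<Rightarrow> 'g gword \<Rightarrow> 'g gword \<Rightarrow> bool" for R where
  refl: "word_eq R u u"
| sym: "word_eq R u v \<Longrightarrow> word_eq R v u"
| trans: "word_eq R u v \<Longrightarrow> word_eq R v w \<Longrightarrow> word_eq R u w"
| cancel: "word_eq R (u @ [(x, b), (x, \<not> b)] @ v) (u @ v)"
| relator: "r \<in> R \<Longrightarrow> word_eq R (u @ r @ v) (u @ v)"

definition word_rel :: "'g gword set \<Rightarrow> ('g gword \<times> 'g gword) set" where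
  "word_rel R = {(u, v). word_eq R u v}"

definition presented_group :: "'g gword set \<Rightarrow> 'g gword set monoid" where
  "presented_group R =
    \<lparr>carrier = UNIV // word_rel R,
     mult = (\<lambda>A B. \<Union>u\<in>A. \<Union>v\<in>B. word_rel R `` {u @ v}),
     one = word_rel R `` {[]}\<rparr>"

lemma equiv_word_rel: "equiv UNIV (word_rel R)"
  by (rule equivI)
    (auto simp: word_rel_def refl_on_def sym_def trans_def
      intro: word_eq.refl word_eq.sym word_eq.trans)

lemma word_eq_context:
  assumes "word_eq R u v"
  shows "word_eq R (p @ u @ q) (p @ v @ q)"
  using assms
proof induction
  case (cancel u x b v)
  show ?case using word_eq.cancel[of R "p @ u" x b "v @ q"] by simp
next
  case (relator r u v)
  show ?case using word_eq.relator[OF relator, of "p @ u" "v @ q"] by simp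
qed (blast intro: word_eq.refl word_eq.sym word_eq.trans)+

lemma word_eq_append:
  assumes "word_eq R u u'" "word_eq R v v'"
  shows "word_eq R (u @ v) (u' @ v')"
  using word_eq_context[OF assms(1), of "[]" v] word_eq_context[OF assms(2), of u' "[]"]
  by (auto intro: word_eq.trans)

lemma presented_group_mult_class:
  "word_rel R `` {u} \<otimes>\<^bsub>presented_group R\<^esub> word_rel R `` {v} = word_rel R `` {u @ v}"
proof -
  have "(\<lambda>u v. word_rel R `` {u @ v}) respects2 word_rel R"
    by (intro congruent2I' equiv_class_eq[OF equiv_word_rel])
      (auto simp: word_rel_def intro: word_eq_append)
  from UN_equiv_class2[OF equiv_word_rel equiv_word_rel this]
  show ?thesis by (simp add: presented_group_def)
qed

lemma word_eq_inverse: "word_eq R (rev (map (\<lambda>(x, b). (x, \<not> b)) u) @ u) []"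
proof (induction u)
  case Nil
  show ?case by (simp add: word_eq.refl)
next
  case (Cons a u)
  obtain x b where a: "a = (x, b)" by fastforce
  show ?case
    using word_eq.cancel[of R "rev (map (\<lambda>(x, b). (x, \<not> b)) u)" x "\<not> b" u] Cons
    by (auto simp: a intro: word_eq.trans)
qed

lemma group_presented_group: "group (presented_group R)"
proof -
  let ?G = "presented_group R"
  let ?c = "\<lambda>u. word_rel R `` {u}"
  have carr: "carrier ?G = range ?c"
    by (auto simp: presented_group_def quotient_def)
  have one: "\<one>\<^bsub>?G\<^esub> = ?c []"
    by (simp add: presented_group_def)
  have inv: "\<exists>v. ?c (v @ u) = ?c []" for u
    by (rule exI[of _ "rev (map (\<lambda>(x, b). (x, \<not> b)) u)"], rule equiv_class_eq[OF equiv_word_rel]) (simp add: word_rel_def word_eq_inverse)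
  show ?thesis
    by (rule groupI)
      (auto simp: carr one presented_group_mult_class inv)
qed

section \<open>The dihedral groups\<close>

datatype dihedral_gen = Rho | Tau

definition dihedral_relators :: "nat \<Rightarrow> dihedral_gen gword set" where
  "dihedral_relators n =
    {replicate n (Rho, True),
     [(Tau, True), (Tau, True)],
     [(Tau, True), (Rho, True), (Tau, True), (Rho, True)]}"

definition dihedral_group :: "nat \<Rightarrow> dihedral_gen gword set monoid" where
  "dihedral_group n = presented_group (dihedral_relators n)"

section \<open>Metrics on groups\<close>

text \<open>\<^locale>\<open>Metric_space\<close> requires non-negativity and symmetry of \<open>d\<close> on the whole type, not
  only on the carrier; this is harmless, as \<open>d\<close> can always be redefined to be 0 off the carrier.\<close>

definition group_metric :: "('a, 'b) monoid_scheme \<Rightarrow> ('a \<Rightarrow> 'a \<Rightarrow> real) \<Rightarrow> bool" where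
  "group_metric G d \<longleftrightarrow>
    Metric_space (carrier G) d \<and>
    (\<forall>g\<in>carrier G. \<forall>h\<in>carrier G. d g h \<in> \<int>) \<and>
    (\<forall>g\<in>carrier G. \<forall>g'\<in>carrier G. \<forall>h\<in>carrier G.
      d (g \<otimes>\<^bsub>G\<^esub> h) (g' \<otimes>\<^bsub>G\<^esub> h) = d g g')"

definition weight :: "('a, 'b) monoid_scheme \<Rightarrow> ('a \<Rightarrow> 'a \<Rightarrow> real) \<Rightarrow> 'a \<Rightarrow> real" where
  "weight G d x = d x \<one>\<^bsub>G\<^esub>"

definition metric_partition :: "('a, 'b) monoid_scheme \<Rightarrow> ('a \<Rightarrow> 'a \<Rightarrow> real) \<Rightarrow> 'a set set" where
  "metric_partition G d =
    carrier G // {(g, h). g \<in> carrier G \<and> h \<in> carrier G \<and> weight G d g = weight G d h}"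

definition interval_metric :: "('a, 'b) monoid_scheme \<Rightarrow> ('a \<Rightarrow> 'a \<Rightarrow> real) \<Rightarrow> bool" where
  "interval_metric G d \<longleftrightarrow>
    group_metric G d \<and>
    finite (weight G d ` carrier G) \<and>
    weight G d ` carrier G = real ` {0..card (metric_partition G d - {{\<one>\<^bsub>G\<^esub>}})}"

definition lee_partition :: "('a, 'b) monoid_scheme \<Rightarrow> 'a set set" where
  "lee_partition G = {{a, inv\<^bsub>G\<^esub> a} | a. a \<in> carrier G}"

definition lee_metric :: "('a, 'b) monoid_scheme \<Rightarrow> ('a \<Rightarrow> 'a \<Rightarrow> real) \<Rightarrow> bool" where
  "lee_metric G d \<longleftrightarrow> interval_metric G d \<and> metric_partition G d = lee_partition G"

end

theory Submission
  imports Defs "HOL-Number_Theory.Cong"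
begin

text \<open>Let \<open>\<rho>\<close> act on the integers modulo \<open>3n\<close> by \<open>x \<mapsto> x + 3\<close> and \<open>\<tau>\<close> by \<open>x \<mapsto> 1 - x\<close>. This is an
  action of the dihedral group, and \<open>f g = g \<cdot> 0\<close> is injective, with \<open>f (\<rho>^k) = 3k\<close> and
  \<open>f (\<rho>^k \<tau>) = 3k + 1\<close>. Let the weight of \<open>g\<close> be the distance of \<open>f g\<close> to 0 on the cycle of length
  \<open>3n\<close>. Since \<open>f (gh) = f g \<plusminus> f h\<close>, it is subadditive. Modulo 3, exactly one of \<open>x\<close> and \<open>-x\<close> is 0
  or 1 unless both are 0, so every distance from 0 to \<open>3n div 2\<close> occurs, and only a rotation can
  share its weight with another element, which is then its inverse.\<close>

section \<open>The distance to zero on a cycle\<close>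

definition cycle_norm :: "int \<Rightarrow> int \<Rightarrow> int" where
  "cycle_norm N x = min (x mod N) (N - x mod N)"

lemma cycle_norm_nonneg: "N > 0 \<Longrightarrow> cycle_norm N x \<ge> 0"
  by (simp add: cycle_norm_def less_imp_le)

lemma cycle_norm_cong: "[x = y] (mod N) \<Longrightarrow> cycle_norm N x = cycle_norm N y"
  by (simp add: cycle_norm_def cong_def)

lemma cycle_norm_minus: "N > 0 \<Longrightarrow> cycle_norm N (- x) = cycle_norm N x"
  by (auto simp: cycle_norm_def zmod_zminus1_eq_if min_def)

lemma cycle_norm_0: "N > 0 \<Longrightarrow> cycle_norm N 0 = 0"
  by (simp add: cycle_norm_def)

lemma cycle_norm_of_le_half: "0 \<le> x \<Longrightarrow> 2 * x \<le> N \<Longrightarrow> N > 0 \<Longrightarrow> cycle_norm N x = x"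
  by (simp add: cycle_norm_def)

lemma cycle_norm_le_half: "cycle_norm N x \<le> N div 2"
  by (simp add: cycle_norm_def min_def) linarith

lemma cycle_norm_triangle:
  assumes "N > 0"
  shows "cycle_norm N (x + y) \<le> cycle_norm N x + cycle_norm N y"
proof -
  define a b where "a = x mod N" and "b = y mod N"
  have "0 \<le> a" "a < N" "0 \<le> b" "b < N"
    using assms by (auto simp: a_def b_def)
  moreover have "(x + y) mod N = (if a + b < N then a + b else a + b - N)"
  proof -
    have "(x + y) mod N = (a + b) mod N"
      by (simp add: a_def b_def mod_add_eq)
    moreover have "(a + b) mod N = a + b - N" if "\<not> a + b < N"
      using that \<open>a < N\<close> \<open>b < N\<close> mod_pos_pos_trivial[of "a + b - N" N] by simp
    ultimately show ?thesis
      using \<open>0 \<le> a\<close> \<open>0 \<le> b\<close> by simp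
  qed
  ultimately show ?thesis
    by (auto simp: cycle_norm_def a_def[symmetric] b_def[symmetric] min_def)
qed

text \<open>The minimum is the length of one of the two arcs to 0; comparing arcs, the residues
  either agree or add up to \<open>N\<close>.\<close>

lemma cycle_norm_eqD:
  assumes "N > 0" "cycle_norm N x = cycle_norm N y"
  shows "[x = y] (mod N) \<or> [x = - y] (mod N)"
proof -
  have "x mod N = y mod N \<or> x mod N = N - y mod N"
    using assms(2) by (auto simp: cycle_norm_def min_def split: if_splits)
  then show ?thesis
  proof
    assume "x mod N = N - y mod N"
    then have "[x = N - y mod N] (mod N)"
      by (metis cong_mod_right cong_refl)
    moreover have "N - y mod N = - y + N * (1 + y div N)"
      by (simp add: minus_mult_div_eq_mod[symmetric] algebra_simps)
    then have "[N - y mod N = - y] (mod N)"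
      by (simp only: cong_def mod_mult_self2)
    ultimately show ?thesis
      by (blast intro: cong_trans)
  qed (simp add: cong_def)
qed

section \<open>Lee metrics from maps to a cycle\<close>

text \<open>The classes are the nonempty fibres of \<open>f\<close>, one for each value. Applied to
  the weight, this counts the parts of the induced partition.\<close>

lemma card_quotient_kernel:
  "card (A // {(x, y). x \<in> A \<and> y \<in> A \<and> f x = f y}) = card (f ` A)"
proof -
  let ?R = "{(x, y). x \<in> A \<and> y \<in> A \<and> f x = f y}"
  have "bij_betw (\<lambda>z. A \<inter> f -` {z}) (f ` A) (A // ?R)"
  proof (rule bij_betw_imageI)
    show "inj_on (\<lambda>z. A \<inter> f -` {z}) (f ` A)"
      by (rule inj_onI) blast
    have "A \<inter> f -` {f x} = ?R `` {x}" if "x \<in> A" for x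
      using that by auto
    then show "(\<lambda>z. A \<inter> f -` {z}) ` f ` A = A // ?R"
      by (auto simp: quotient_def image_iff)
  qed
  then show ?thesis
    by (simp add: bij_betw_same_card)
qed

text \<open>The norm ignores signs, so a product formula up to the sign of \<open>f h\<close> gives
  subadditivity, and reaching one of \<open>x\<close> and \<open>- x\<close> gives all weights.
  \<open>inj\<close> and \<open>neg\<close> confine the elements with the weight of \<open>g\<close>
  to \<open>{g, inv g}\<close>.\<close>

lemma (in group) lee_metric_from_cycle_map:
  fixes f :: "'a \<Rightarrow> int"
  assumes N: "N > 0"
    and one: "[f \<one> = 0] (mod N)"
    and mult: "\<And>g h. g \<in> carrier G \<Longrightarrow> h \<in> carrier G \<Longrightarrow>
        [f (g \<otimes> h) = f g + f h] (mod N) \<or> [f (g \<otimes> h) = f g - f h] (mod N)"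
    and inj: "\<And>g h. g \<in> carrier G \<Longrightarrow> h \<in> carrier G \<Longrightarrow> [f g = f h] (mod N) \<Longrightarrow> g = h"
    and neg: "\<And>g h. g \<in> carrier G \<Longrightarrow> h \<in> carrier G \<Longrightarrow> [f g = - f h] (mod N) \<Longrightarrow> g = h \<or> g = inv h"
    and surj: "\<And>x. \<exists>g\<in>carrier G. [f g = x] (mod N) \<or> [f g = - x] (mod N)"
  shows "\<exists>d. lee_metric G d"
proof -
  define w where "w g = cycle_norm N (f g)" for g
  \<comment> \<open>Building \<open>d\<close> from \<open>g \<otimes> inv h\<close> ensures right
    invariance. The value 0 off the carrier keeps \<open>d\<close> nonnegative and symmetric on the
    whole type.\<close>
  define d :: "'a \<Rightarrow> 'a \<Rightarrow> real" where
    "d g h = (if g \<in> carrier G \<and> h \<in> carrier G then of_int (w (g \<otimes> inv h)) else 0)" for g h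
  have w_one: "w \<one> = 0"
    by (simp add: w_def cycle_norm_0[OF N] cycle_norm_cong[OF one])
  have w_mult: "w (g \<otimes> h) \<le> w g + w h" if "g \<in> carrier G" "h \<in> carrier G" for g h
    using mult[OF that] cycle_norm_triangle[OF N, of "f g" "f h"]
      cycle_norm_triangle[OF N, of "f g" "- f h"]
    by (auto simp: w_def cycle_norm_minus[OF N] dest: cycle_norm_cong)
  have w_inv: "w (inv g) = w g" if g: "g \<in> carrier G" for g
  proof -
    \<comment> \<open>Since \<open>f \<one>\<close> is 0 modulo \<open>N\<close>, the product
      formula forces \<open>f (inv g)\<close> to be \<open>f g\<close> up to sign.\<close>
    have "[f \<one> = f g + f (inv g)] (mod N) \<or> [f \<one> = f g - f (inv g)] (mod N)"
      using mult[of g "inv g"] g by simp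
    then have "[f g + f (inv g) = 0] (mod N) \<or> [f g - f (inv g) = 0] (mod N)"
      using cong_trans[OF cong_sym one] by blast
    then have "[f g = - f (inv g)] (mod N) \<or> [f g = f (inv g)] (mod N)"
      by (simp add: cong_iff_dvd_diff)
    then show ?thesis
      by (auto simp: w_def cycle_norm_minus[OF N] dest: cycle_norm_cong)
  qed
  have w_eq: "w g = w h \<longleftrightarrow> h \<in> {g, inv g}" if "g \<in> carrier G" "h \<in> carrier G" for g h
  proof
    assume "w g = w h"
    then have "[f h = f g] (mod N) \<or> [f h = - f g] (mod N)"
      by (intro cycle_norm_eqD[OF N]) (simp add: w_def)
    then show "h \<in> {g, inv g}"
      using that inj neg by blast
  qed (use that w_inv in auto)
  have w_range: "w ` carrier G = {0..N div 2}"
  proof (intro equalityI subsetI)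
    fix x assume x: "x \<in> {0..N div 2}"
    obtain g where "g \<in> carrier G" "[f g = x] (mod N) \<or> [f g = - x] (mod N)"
      using surj by blast
    \<comment> \<open>Up to half the cycle, \<open>x\<close> is its own norm, whichever of
      \<open>x\<close> and \<open>- x\<close> is hit.\<close>
    moreover from this have "w g = x"
      using x N by (auto simp: w_def cycle_norm_minus cycle_norm_of_le_half dest!: cycle_norm_cong)
    ultimately show "x \<in> w ` carrier G" by blast
  qed (auto simp: w_def cycle_norm_nonneg[OF N] cycle_norm_le_half)
  have weight: "weight G d g = of_int (w g)" if "g \<in> carrier G" for g
    using that by (simp add: weight_def d_def)
  have "Metric_space (carrier G) d"
  proof
    show "0 \<le> d g h" for g h
      by (simp add: d_def w_def cycle_norm_nonneg[OF N])
    show "d g h = d h g" for g h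
      using w_inv[of "g \<otimes> inv h"] by (auto simp: d_def inv_mult_group)
    show "d g h = 0 \<longleftrightarrow> g = h" if "g \<in> carrier G" "h \<in> carrier G" for g h
      using that w_one w_eq[of \<one> "g \<otimes> inv h"] by (auto simp: d_def) (metis inv_equality inv_inv inv_closed)
    show "d g k \<le> d g h + d h k"
      if "g \<in> carrier G" "h \<in> carrier G" "k \<in> carrier G" for g h k
    proof -
      have "g \<otimes> inv k = (g \<otimes> inv h) \<otimes> (h \<otimes> inv k)"
        using that by (metis inv_closed inv_solve_left m_assoc m_closed)
      then show ?thesis
        using that w_mult[of "g \<otimes> inv h" "h \<otimes> inv k"] by (simp add: d_def)
    qed
  qed
  moreover have "d (g \<otimes> k) (h \<otimes> k) = d g h"
    if "g \<in> carrier G" "h \<in> carrier G" "k \<in> carrier G" for g h k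
  proof -
    have "g \<otimes> k \<otimes> inv (h \<otimes> k) = g \<otimes> inv h"
      using that by (simp add: inv_mult_group m_assoc) (metis inv_closed inv_solve_left m_assoc m_closed r_inv r_one)
    then show ?thesis
      using that by (simp add: d_def)
  qed
  ultimately have metric: "group_metric G d"
    by (auto simp: group_metric_def d_def)
  let ?R = "{(g, h). g \<in> carrier G \<and> h \<in> carrier G \<and> weight G d g = weight G d h}"
  have "?R `` {g} = {g, inv g}" if "g \<in> carrier G" for g
    using that w_eq by (auto simp: weight)
  then have partition: "metric_partition G d = lee_partition G"
    by (auto simp: metric_partition_def lee_partition_def quotient_def)
  have range: "weight G d ` carrier G = real ` {0..nat (N div 2)}"
  proof -
    have "weight G d ` carrier G = of_int ` w ` carrier G"
      by (auto simp: weight image_image cong: image_cong)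
    also have "\<dots> = of_int ` int ` {0..nat (N div 2)}"
      using N by (simp add: w_range image_int_atLeastAtMost)
    finally show ?thesis
      by (simp add: image_image)
  qed
  \<comment> \<open>The weights \<open>0..N div 2\<close> give \<open>N div 2 + 1\<close> parts. As
    \<open>\<one>\<close> is its own inverse, \<open>{\<one>}\<close> is one of them, and the number
    of the others is the largest weight.\<close>
  have "{\<one>} \<in> lee_partition G"
    by (auto simp: lee_partition_def intro!: exI[of _ \<one>])
  moreover have "card (lee_partition G) = Suc (nat (N div 2))"
    using card_quotient_kernel[of "carrier G" "weight G d"]
    by (simp add: partition[symmetric] metric_partition_def range card_image)
  ultimately have "card (metric_partition G d - {{\<one>}}) = nat (N div 2)"
    by (simp add: partition)
  then have "lee_metric G d"
    by (simp add: lee_metric_def interval_metric_def metric partition range)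
  then show ?thesis by blast
qed

section \<open>The action of the dihedral group\<close>

text \<open>Words act on all integers, the last letter first; \<open>n\<close> enters only through
  congruences. The sign of a \<open>Tau\<close> letter is ignored because \<open>1 - x\<close> is an
  involution.\<close>

fun dihedral_act :: "dihedral_gen gword \<Rightarrow> int \<Rightarrow> int" where
  "dihedral_act [] x = x"
| "dihedral_act ((Rho, b) # u) x = dihedral_act u x + (if b then 3 else - 3)"
| "dihedral_act ((Tau, b) # u) x = 1 - dihedral_act u x"

lemma dihedral_act_append: "dihedral_act (u @ v) x = dihedral_act u (dihedral_act v x)"
  by (induction u x rule: dihedral_act.induct) auto

text \<open>The image of 0 modulo 3 tells translations from reflections: a shift by 3 preserves the
  residue, while \<open>1 - x\<close> swaps the residues 0 and 1 and turns one kind of map into the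
  other.\<close>

lemma dihedral_act_eq:
  "dihedral_act u 0 mod 3 = 0 \<and> dihedral_act u x = dihedral_act u 0 + x \<or>
   dihedral_act u 0 mod 3 = 1 \<and> dihedral_act u x = dihedral_act u 0 - x"
  by (induction u x rule: dihedral_act.induct) (auto, presburger+)

lemma dihedral_act_cong:
  assumes "[x = y] (mod N)"
  shows "[dihedral_act u x = dihedral_act u y] (mod N)"
  using dihedral_act_eq[of u x] dihedral_act_eq[of u y]
    cong_add[OF cong_refl assms] cong_diff[OF cong_refl assms]
  by auto

lemma dihedral_act_replicate: "dihedral_act (replicate k (Rho, True)) x = x + 3 * int k"
  by (induction k) auto

text \<open>This makes the action modulo \<open>3 * n\<close> well defined on group
  elements.\<close>

lemma dihedral_act_word_eq:
  assumes "word_eq (dihedral_relators n) u v"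
  shows "[dihedral_act u x = dihedral_act v x] (mod 3 * int n)"
  using assms
proof (induction arbitrary: x)
  case (cancel u y b v)
  show ?case by (cases y) (auto simp: dihedral_act_append)
next
  case (relator r u v)
  \<comment> \<open>Only the power of \<open>Rho\<close> uses the modulus: it shifts by
    \<open>3 * n\<close>. The other relators fix every integer.\<close>
  have "[dihedral_act r y = y] (mod 3 * int n)" for y
    using relator by (auto simp: dihedral_relators_def dihedral_act_replicate cong_def)
  then show ?case
    by (simp add: dihedral_act_append dihedral_act_cong)
qed (auto intro: cong_sym cong_trans)

section \<open>Normal forms in the dihedral group\<close>

text \<open>The relations say that \<open>t\<close> conjugates \<open>r\<close> to its inverse, so
  \<open>t\<close> can be moved past any power of \<open>r\<close>.\<close>

lemma (in group) involution_mult_int_pow: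
  assumes r: "r \<in> carrier G" and t: "t \<in> carrier G"
    and tt: "t \<otimes> t = \<one>" and trtr: "t \<otimes> (r \<otimes> (t \<otimes> r)) = \<one>"
  shows "t \<otimes> r [^] (k :: int) = r [^] (- k) \<otimes> t"
proof -
  \<comment> \<open>\<open>trtr\<close> makes \<open>t\<close> the inverse of the left side, and
    \<open>tt\<close> makes \<open>t\<close> its own inverse.\<close>
  have "r \<otimes> (t \<otimes> r) = t"
    using inv_equality[OF trtr] inv_equality[OF tt] r t by (metis inv_inv m_closed)
  then have tr: "t \<otimes> r = inv r \<otimes> t"
    using r t by (metis inv_solve_left m_closed)
  then have tr': "t \<otimes> inv r = r \<otimes> t"
    using r t by (metis inv_closed inv_solve_left inv_solve_right m_assoc m_closed)
  show ?thesis
  proof (induction k rule: int_induct[where k = 0])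
    case base
    show ?case using t by simp
  next
    case (step1 i)
    have "t \<otimes> r [^] (i + 1) = (t \<otimes> r [^] i) \<otimes> r"
      using r t by (simp add: int_pow_mult m_assoc)
    also have "\<dots> = r [^] (- i) \<otimes> inv r \<otimes> t"
      using r t by (simp add: step1 m_assoc tr)
    also have "r [^] (- i) \<otimes> inv r = r [^] (- i + - 1)"
      using r by (simp only: int_pow_mult int_pow_neg int_pow_1)
    finally show ?case by simp
  next
    case (step2 i)
    have "t \<otimes> r [^] (i - 1) = t \<otimes> r [^] (i + - 1)" by simp
    also have "\<dots> = (t \<otimes> r [^] i) \<otimes> inv r"
      using r t by (simp add: int_pow_mult int_pow_neg m_assoc del: add_uminus_conv_diff)
    also have "\<dots> = r [^] (- i) \<otimes> r \<otimes> t"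
      using r t by (simp add: step2 m_assoc tr')
    also have "r [^] (- i) \<otimes> r = r [^] (- i + 1)"
      using r by (simp only: int_pow_mult int_pow_1)
    finally show ?case by simp
  qed
qed

text \<open>The image of 0 determines a normal form \<open>r^k\<close> or \<open>r^k t\<close> of
  the word, and images congruent modulo \<open>3 * n\<close> give the same form with exponents that
  differ by a multiple of \<open>n\<close>.\<close>

lemma dihedral_act_inj:
  assumes "[dihedral_act u 0 = dihedral_act v 0] (mod 3 * int n)"
  shows "word_rel (dihedral_relators n) `` {u} = word_rel (dihedral_relators n) `` {v}"
proof -
  let ?R = "dihedral_relators n"
  define G where "G = presented_group ?R"
  interpret group G
    unfolding G_def by (rule group_presented_group)
  define c where "c w = word_rel ?R `` {w}" for w
  define r t where "r = c [(Rho, True)]" and "t = c [(Tau, True)]"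
  have c_closed: "c w \<in> carrier G" for w
    by (auto simp: c_def G_def presented_group_def quotient_def)
  note rt = c_closed[of "[(Rho, True)]", folded r_def] c_closed[of "[(Tau, True)]", folded t_def]
  have c_Nil: "c [] = \<one>\<^bsub>G\<^esub>"
    by (simp add: c_def G_def presented_group_def)
  have c_append: "c (w @ w') = c w \<otimes>\<^bsub>G\<^esub> c w'" for w w'
    by (simp add: c_def G_def presented_group_mult_class)
  have c_Cons: "c (a # w) = c [a] \<otimes>\<^bsub>G\<^esub> c w" for a w
    using c_append[of "[a]" w] by simp
  have c_eq: "c w = c w'" if "word_eq ?R w w'" for w w'
    unfolding c_def using that by (intro equiv_class_eq[OF equiv_word_rel]) (simp add: word_rel_def)
  have c_relator: "c w = \<one>\<^bsub>G\<^esub>" if "w \<in> ?R" for w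
    using c_eq[OF word_eq.relator[OF that, of "[]" "[]"]] by (simp add: c_Nil)
  have tt: "t \<otimes>\<^bsub>G\<^esub> t = \<one>\<^bsub>G\<^esub>"
    using c_relator[of "[(Tau, True), (Tau, True)]"]
    by (simp add: dihedral_relators_def t_def c_append[symmetric])
  have trtr: "t \<otimes>\<^bsub>G\<^esub> (r \<otimes>\<^bsub>G\<^esub> (t \<otimes>\<^bsub>G\<^esub> r)) = \<one>\<^bsub>G\<^esub>"
    using c_relator[of "[(Tau, True), (Rho, True), (Tau, True), (Rho, True)]"]
    by (simp add: dihedral_relators_def r_def t_def c_append[symmetric])
  have c_replicate: "c (replicate k (Rho, True)) = r [^]\<^bsub>G\<^esub> k" for k :: nat
    by (induction k) (simp_all add: c_Nil c_append r_def replicate_append_same[symmetric] del: replicate_append_same)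
  have rn: "r [^]\<^bsub>G\<^esub> int n = \<one>\<^bsub>G\<^esub>"
    using c_relator[of "replicate n (Rho, True)"]
    by (simp add: dihedral_relators_def c_replicate int_pow_int)
  have c_inverse: "c [(x, False)] = inv\<^bsub>G\<^esub> c [(x, True)]" for x
    using c_eq[OF word_eq.cancel[of ?R "[]" x False "[]"]] c_closed
    by (intro inv_equality[symmetric]) (simp_all add: c_Nil c_append[symmetric])
  have c_Rho: "c [(Rho, b)] = r [^]\<^bsub>G\<^esub> (if b then 1 else - 1 :: int)" for b
    using rt by (cases b) (simp_all add: r_def c_inverse int_pow_neg)
  have "inv\<^bsub>G\<^esub> t = t"
    using rt tt by (simp add: inv_equality)
  then have c_Tau: "c [(Tau, b)] = t" for b
    by (cases b) (simp_all add: t_def c_inverse)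
  note swap = involution_mult_int_pow[OF rt tt trtr]
  \<comment> \<open>\<open>p\<close> reads the group element off the image of 0:
    \<open>3 * k\<close> stands for \<open>r^k\<close> and \<open>3 * k + 1\<close> for
    \<open>r^k t\<close>.\<close>
  define p where "p x = r [^]\<^bsub>G\<^esub> (x div 3) \<otimes>\<^bsub>G\<^esub> (if x mod 3 = 0 then \<one>\<^bsub>G\<^esub> else t)" for x :: int
  have normal_form: "c w = p (dihedral_act w 0)" for w
  proof (induction w)
    case Nil
    show ?case by (simp add: p_def c_Nil)
  next
    case (Cons a w)
    define x where "x = dihedral_act w 0"
    have IH: "c w = p x"
      by (simp add: Cons.IH x_def)
    have x: "x mod 3 = 0 \<or> x mod 3 = 1"
      using dihedral_act_eq[of w 0] by (auto simp: x_def)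
    obtain y b where a: "a = (y, b)" by fastforce
    show ?case
    proof (cases y)
      case Rho
      define e :: int where "e = (if b then 1 else - 1)"
      have act: "dihedral_act (a # w) 0 = x + 3 * e"
        by (simp add: a Rho x_def e_def)
      have "c (a # w) = r [^]\<^bsub>G\<^esub> e \<otimes>\<^bsub>G\<^esub> p x"
        by (simp only: c_Cons[of a w], simp only: IH a Rho c_Rho e_def)
      also have "\<dots> = p (x + 3 * e)"
        using rt by (simp add: p_def m_assoc[symmetric] int_pow_mult[symmetric] add.commute)
      finally show ?thesis
        by (simp only: act)
    next
      case Tau
      have act: "dihedral_act (a # w) 0 = 1 - x"
        by (simp add: a Tau x_def)
      have "c (a # w) = t \<otimes>\<^bsub>G\<^esub> p x"
        by (simp only: c_Cons[of a w], simp only: IH a Tau c_Tau)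
      also have "\<dots> = p (1 - x)"
        using x
      proof
        assume x0: "x mod 3 = 0"
        \<comment> \<open>For \<open>x = 3 * k\<close>, \<open>1 - x = 3 * (- k) + 1\<close>,
          matching \<open>t r^k = r^(-k) t\<close>.\<close>
        then have "(1 - x) mod 3 = 1" "(1 - x) div 3 = - (x div 3)"
          by presburger+
        with x0 show ?thesis
          using rt swap by (simp add: p_def)
      next
        assume x1: "x mod 3 = 1"
        \<comment> \<open>For \<open>x = 3 * k + 1\<close>, \<open>1 - x = 3 * (- k)\<close>,
          matching \<open>t r^k t = r^(-k)\<close>.\<close>
        then have "(1 - x) mod 3 = 0" "(1 - x) div 3 = - (x div 3)"
          by presburger+
        with x1 show ?thesis
          using rt swap by (simp add: p_def m_assoc[symmetric]) (simp add: m_assoc tt)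
      qed
      finally show ?thesis
        by (simp only: act)
    qed
  qed
  obtain k where k: "dihedral_act v 0 = dihedral_act u 0 + 3 * (int n * k)"
    using assms by (auto simp: cong_iff_lin mult.assoc)
  have "r [^]\<^bsub>G\<^esub> (int n * k) = \<one>\<^bsub>G\<^esub>"
    using rt by (simp add: int_pow_pow[symmetric] rn)
  then have "p (x + 3 * (int n * k)) = p x" for x
    using rt by (simp add: p_def int_pow_mult)
  then show ?thesis
    using normal_form[of u] normal_form[of v] by (simp add: k c_def)
qed

section \<open>The dihedral action as a map to the cycle\<close>

theorem theorem3p6:
  fixes n :: nat
  assumes "n \<ge> 1"
  shows "\<exists>d. lee_metric (dihedral_group n) d"
proof -
  let ?R = "dihedral_relators n" and ?N = "3 * int n"
  define G where "G = presented_group ?R"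
  interpret group G
    unfolding G_def by (rule group_presented_group)
  define c where "c w = word_rel ?R `` {w}" for w
  have carrier: "carrier G = range c"
    by (auto simp: c_def G_def presented_group_def quotient_def)
  have c_Nil: "c [] = \<one>\<^bsub>G\<^esub>"
    by (simp add: c_def G_def presented_group_def)
  have c_append: "c w \<otimes>\<^bsub>G\<^esub> c w' = c (w @ w')" for w w'
    by (simp add: c_def G_def presented_group_mult_class)
  \<comment> \<open>The word representing \<open>g\<close> is an arbitrary choice, so
    \<open>f g\<close> is controlled only modulo \<open>3 * n\<close>.\<close>
  define f where "f g = dihedral_act (SOME w. c w = g) 0" for g
  have f_c: "[f (c w) = dihedral_act w 0] (mod ?N)" for w
  proof -
    have "c (SOME w'. c w' = c w) = c w"
      by (rule someI[of "\<lambda>w'. c w' = c w"]) simp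
    then have "word_eq ?R (SOME w'. c w' = c w) w"
      using eq_equiv_class[OF _ equiv_word_rel UNIV_I] unfolding c_def word_rel_def by blast
    then show ?thesis
      unfolding f_def by (rule dihedral_act_word_eq)
  qed
  have c_inj: "c u = c v" if "[dihedral_act u 0 = dihedral_act v 0] (mod ?N)" for u v
    using dihedral_act_inj[OF that] by (simp add: c_def)
  have "\<exists>d. lee_metric G d"
  proof (rule lee_metric_from_cycle_map)
    show "?N > 0" using assms by simp
    show "[f \<one>\<^bsub>G\<^esub> = 0] (mod ?N)"
      using f_c[of "[]"] by (simp add: c_Nil)
  next
    fix g h assume "g \<in> carrier G" "h \<in> carrier G"
    then obtain u v where g: "g = c u" and h: "h = c v"
      by (auto simp: carrier)
    have gh: "[f (g \<otimes>\<^bsub>G\<^esub> h) = dihedral_act u (dihedral_act v 0)] (mod ?N)"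
      using f_c[of "u @ v"] by (simp add: g h c_append dihedral_act_append)
    have fg: "[dihedral_act u 0 = f g] (mod ?N)" and fh: "[dihedral_act v 0 = f h] (mod ?N)"
      using f_c cong_sym by (auto simp: g h)
    \<comment> \<open>The sign is plus if \<open>u\<close> acts as a translation and minus if it
      acts as a reflection.\<close>
    show "[f (g \<otimes>\<^bsub>G\<^esub> h) = f g + f h] (mod ?N) \<or> [f (g \<otimes>\<^bsub>G\<^esub> h) = f g - f h] (mod ?N)"
      using gh dihedral_act_eq[of u "dihedral_act v 0"] cong_add[OF fg fh] cong_diff[OF fg fh]
      by (metis cong_trans)
    show "g = h" if "[f g = f h] (mod ?N)"
      unfolding g h
      by (rule c_inj) (meson fg fh that cong_sym cong_trans)
    show "g = h \<or> g = inv\<^bsub>G\<^esub> h" if "[f g = - f h] (mod ?N)"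
    proof -
      have neg: "[dihedral_act u 0 = - dihedral_act v 0] (mod ?N)"
        using fg fh that by (meson cong_minus_minus_iff cong_sym cong_trans)
      \<comment> \<open>Modulo 3 both images are 0 or 1 and they add up to 0, so both are 0. Hence
        \<open>u\<close> acts as a translation, and \<open>u @ v\<close> takes 0 to the sum of the
        two images, which is 0 modulo \<open>3 * n\<close>.\<close>
      then have "[dihedral_act u 0 = - dihedral_act v 0] (mod 3)"
        by (rule cong_modulus_mult)
      then have "dihedral_act u 0 mod 3 = 0"
        using dihedral_act_eq[of u 0] dihedral_act_eq[of v 0] unfolding cong_def by presburger
      then have "dihedral_act (u @ v) 0 = dihedral_act u 0 + dihedral_act v 0"
        using dihedral_act_eq[of u "dihedral_act v 0"] by (simp add: dihedral_act_append)
      then have "c (u @ v) = c []"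
        using neg by (intro c_inj) (simp add: cong_iff_dvd_diff)
      then have "g \<otimes>\<^bsub>G\<^esub> h = \<one>\<^bsub>G\<^esub>"
        by (simp add: g h c_append c_Nil)
      then show ?thesis
        by (metis \<open>g \<in> carrier G\<close> \<open>h \<in> carrier G\<close> inv_equality)
    qed
  next
    fix x :: int
    have rotation: "\<exists>w. [dihedral_act w y = 3 * k + y] (mod ?N)" for k y
    proof -
      \<comment> \<open>A word of positive letters needs a natural exponent, so \<open>k\<close> is
        reduced modulo \<open>n\<close>, which changes the shift by a multiple of
        \<open>3 * n\<close>.\<close>
      have "3 * (k mod int n) + y = 3 * k + y + ?N * - (k div int n)"
        by (simp add: minus_mult_div_eq_mod[symmetric] algebra_simps)
      then have "[3 * (k mod int n) + y = 3 * k + y] (mod ?N)"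
        by (simp only: cong_def mod_mult_self2)
      then show ?thesis
        using assms by (intro exI[of _ "replicate (nat (k mod int n)) (Rho, True)"])
          (simp add: dihedral_act_replicate add.commute)
    qed
    have "\<exists>w. [dihedral_act w 0 = x] (mod ?N) \<or> [dihedral_act w 0 = - x] (mod ?N)"
    proof -
      \<comment> \<open>If \<open>x\<close> has residue 2 modulo 3, then \<open>- x\<close> has
        residue 1. The summand 0 fits \<open>rotation\<close> with \<open>y = 0\<close>.\<close>
      have "(\<exists>k. x = 3 * k + 0) \<or> (\<exists>k. x = 3 * k + 1) \<or> (\<exists>k. - x = 3 * k + 1)"
        by presburger
      moreover have "\<exists>w. [dihedral_act w 0 = 3 * k + 1] (mod ?N)" for k
      proof -
        obtain w where "[dihedral_act w 1 = 3 * k + 1] (mod ?N)"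
          using rotation by blast
        then show ?thesis
          \<comment> \<open>\<open>Tau\<close> acts first and takes 0 to 1, from where the rotation
            reaches \<open>3 * k + 1\<close>.\<close>
          by (intro exI[of _ "w @ [(Tau, True)]"]) (simp add: dihedral_act_append)
      qed
      ultimately show ?thesis
        using rotation[of 0] by metis
    qed
    then show "\<exists>g\<in>carrier G. [f g = x] (mod ?N) \<or> [f g = - x] (mod ?N)"
      unfolding carrier using cong_trans[OF f_c] by blast
  qed
  then show ?thesis
    by (simp add: dihedral_group_def G_def)
qed

end
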